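(* Let $A$ be a finite nonempty set, let $\rho\subseteq A^2$ be an equivalence relation on $A$, and let $F=\mathrm{Pol}\,\rho$. Then each invariant relation of the clone $F$ is a generalized quasiorder and can be obtained from $\rho$ by a primitive positive formula without quantifiers, i.e., $$\mathrm{gQuord}\,F=\mathrm{Inv}\,F=[\rho]_{(\exists,\land,=)}=[\rho]_{(\land,=)}.$$
   Context: All operations $f:A^n\to A$ and relations $\sigma\subseteq A^m$ have finite arity $n,m\ge 1$. An operation $f:A^n\to A$ preserves $\sigma\subseteq A^m$ if applying $f$ componentwise to any $r_1,\dots,r_n\in\sigma$ gives a tuple in $\sigma$. $\mathrm{Pol}\,\rho$ is the set of all finitary operations on $A$ preserving $\rho$; it is a clone, i.e. a set of operations containing all projections and closed under composition. For a set $F$ of operations, $\mathrm{Inv}\,F$ is the set of all relations on $A$ (of all arities) preserved by every $f\in F$; its members are the invariant relations of $F$. A relation $\sigma\subseteq A^m$ is reflexive if $(a,\dots,a)\in\sigma$ for all $a\in A$; it is (generalized) transitive if for every matrix $(a_{ij})\in A^{m\times m}$ all of whose rows and all of whose columns belong to $\sigma$, the diagonal $(a_{11},\dots,a_{mm})$ belongs to $\sigma$. A generalized quasiorder is a reflexive and transitive relation $\sigma\subseteq A^m$ for some $m\ge1$. $\mathrm{gQuord}\,F$ is the set of all generalized quasiorders belonging to $\mathrm{Inv}\,F$. $[\rho]_{(\exists,\land,=)}$ is the set of all relations $\{(a_1,\dots,a_m)\in A^m\mid \varphi(a_1,\dots,a_m)\}$, $m\ge1$, definable by a primitive positive formula $\varphi(x_1,\dots,x_m)$,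 i.e. an existentially quantified finite conjunction of atomic formulas $(z,z')\in\rho$ or $z=z'$ ($z,z'$ variables). $[\rho]_{(\land,=)}$ is the set of those definable by such formulas without quantifiers.
   Formalization: Inv F is taken to consist of the nonempty invariant relations only; the empty relation is preserved by every operation but is neither reflexive nor primitive positive definable from ρ, so the stated equalities fail if it is included. *)

theory Defs
  imports "HOL-Library.FuncSet"
begin

text \<open>
  The base set is an explicit carrier \<open>A\<close>; \<open>m\<close>-tuples over \<open>A\<close> are lists of length \<open>m\<close>,
  with positions numbered from \<open>0\<close>.
\<close>

definition tuples :: "'a set \<Rightarrow> nat \<Rightarrow> 'a list set" where
  "tuples A m = {xs. length xs = m \<and> set xs \<subseteq> A}"

text \<open>
  Convention: the relations making up \<open>Inv F\<close> are nonempty. The empty set is preserved by every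
  operation of positive arity, but it is not reflexive over a nonempty \<open>A\<close> and is not definable
  by a primitive positive formula over a reflexive relation, so it must be disregarded for
  \<open>gQuord F = Inv F\<close> to hold for any \<open>F\<close>. A nonempty set of tuples also determines its arity.
\<close>

definition relations :: "'a set \<Rightarrow> nat \<Rightarrow> 'a list set set" where
  "relations A m = {\<sigma>. \<sigma> \<subseteq> tuples A m \<and> \<sigma> \<noteq> {}}"

text \<open>
  A finitary operation is a pair of its arity and a function on tuples of that length
  (\<open>undefined\<close> elsewhere, so that distinct pairs are distinct operations).
\<close>

type_synonym 'a operation = "nat \<times> ('a list \<Rightarrow> 'a)"

definition operations :: "'a set \<Rightarrow> 'a operation set" where
  "operations A = {(n, f). 1 \<le> n \<and> f \<in> tuples A n \<rightarrow>\<^sub>E A}"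

fun preserves :: "'a operation \<Rightarrow> nat \<Rightarrow> 'a list set \<Rightarrow> bool" where
  "preserves (n, f) m \<sigma> \<longleftrightarrow>
     (\<forall>rs. length rs = n \<longrightarrow> set rs \<subseteq> \<sigma> \<longrightarrow> map (\<lambda>i. f (map (\<lambda>r. r ! i) rs)) [0..<m] \<in> \<sigma>)"

definition binary_tuples :: "('a \<times> 'a) set \<Rightarrow> 'a list set" where
  "binary_tuples \<rho> = {[x, y] | x y. (x, y) \<in> \<rho>}"

definition Pol :: "'a set \<Rightarrow> ('a \<times> 'a) set \<Rightarrow> 'a operation set" where
  "Pol A \<rho> = {g \<in> operations A. preserves g 2 (binary_tuples \<rho>)}"

definition Inv :: "'a set \<Rightarrow> 'a operation set \<Rightarrow> 'a list set set" where
  "Inv A F = {\<sigma>. \<exists>m\<ge>1. \<sigma> \<in> relations A m \<and> (\<forall>g\<in>F. preserves g m \<sigma>)}"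

definition gen_reflexive :: "'a set \<Rightarrow> nat \<Rightarrow> 'a list set \<Rightarrow> bool" where
  "gen_reflexive A m \<sigma> \<longleftrightarrow> (\<forall>a\<in>A. replicate m a \<in> \<sigma>)"

text \<open>The entry of the matrix in row \<open>i\<close> and column \<open>j\<close> is \<open>M i j\<close>.\<close>

definition gen_transitive :: "'a set \<Rightarrow> nat \<Rightarrow> 'a list set \<Rightarrow> bool" where
  "gen_transitive A m \<sigma> \<longleftrightarrow>
     (\<forall>M. (\<forall>i<m. \<forall>j<m. M i j \<in> A) \<longrightarrow>
          (\<forall>i<m. map (\<lambda>j. M i j) [0..<m] \<in> \<sigma>) \<longrightarrow>
          (\<forall>j<m. map (\<lambda>i. M i j) [0..<m] \<in> \<sigma>) \<longrightarrow>
          map (\<lambda>i. M i i) [0..<m] \<in> \<sigma>)"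

definition gen_quasiorder :: "'a set \<Rightarrow> 'a list set \<Rightarrow> bool" where
  "gen_quasiorder A \<sigma> \<longleftrightarrow>
     (\<exists>m\<ge>1. \<sigma> \<subseteq> tuples A m \<and> gen_reflexive A m \<sigma> \<and> gen_transitive A m \<sigma>)"

definition gQuord :: "'a set \<Rightarrow> 'a operation set \<Rightarrow> 'a list set set" where
  "gQuord A F = {\<sigma> \<in> Inv A F. gen_quasiorder A \<sigma>}"

text \<open>
  Primitive positive formulas in prenex form: a list of atoms stands for their conjunction.
  Variables are indices into a tuple of values; in a formula with \<open>m\<close> free and \<open>k\<close> quantified
  variables, the free ones are \<open>0, \<dots>, m - 1\<close> and the quantified ones \<open>m, \<dots>, m + k - 1\<close>.
\<close>

datatype atom = Rel_Atom nat nat | Eq_Atom nat nat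

fun vars :: "atom \<Rightarrow> nat set" where
  "vars (Rel_Atom i j) = {i, j}"
| "vars (Eq_Atom i j) = {i, j}"

fun satisfies :: "('a \<times> 'a) set \<Rightarrow> 'a list \<Rightarrow> atom \<Rightarrow> bool" where
  "satisfies \<rho> xs (Rel_Atom i j) \<longleftrightarrow> (xs ! i, xs ! j) \<in> \<rho>"
| "satisfies \<rho> xs (Eq_Atom i j) \<longleftrightarrow> xs ! i = xs ! j"

definition pp_definable :: "'a set \<Rightarrow> ('a \<times> 'a) set \<Rightarrow> 'a list set set" where
  "pp_definable A \<rho> =
     {{xs \<in> tuples A m. \<exists>ys \<in> tuples A k. \<forall>\<alpha> \<in> set \<phi>. satisfies \<rho> (xs @ ys) \<alpha>} | m k \<phi>.
        1 \<le> m \<and> (\<forall>\<alpha> \<in> set \<phi>. vars \<alpha> \<subseteq> {..<m + k})}"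

definition qf_pp_definable :: "'a set \<Rightarrow> ('a \<times> 'a) set \<Rightarrow> 'a list set set" where
  "qf_pp_definable A \<rho> =
     {{xs \<in> tuples A m. \<forall>\<alpha> \<in> set \<phi>. satisfies \<rho> xs \<alpha>} | m \<phi>.
        1 \<le> m \<and> (\<forall>\<alpha> \<in> set \<phi>. vars \<alpha> \<subseteq> {..<m})}"

end

theory Submission
  imports Defs
begin

text \<open>
  An invariant relation \<open>\<sigma>\<close> of \<open>Pol \<rho>\<close> is defined by the conjunction of all the atoms that
  hold throughout \<open>\<sigma>\<close>. Indeed, list the tuples of \<open>\<sigma>\<close> as the rows of a matrix and let a tuple
  \<open>xs\<close> satisfy these atoms. Sending the \<open>i\<close>-th column to \<open>xs\<^sub>i\<close> is well defined by the equality
  atoms; it extends to an operation that preserves \<open>\<rho>\<close>, because a vector that is componentwise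
  equivalent to some column may be sent to the value at such a column (all choices are equivalent
  by the \<open>\<rho>\<close>-atoms) and the remaining vectors to a constant. As this operation maps the rows of
  the matrix to \<open>xs\<close>, invariance gives \<open>xs \<in> \<sigma>\<close>.
\<close>

section \<open>Operations compatible with a binary relation\<close>

text \<open>A list of pairs from \<rho> amounts to two argument lists related entry by entry, its
  first and its second components. In this form polymorphisms are easier both to apply and to
  construct.\<close>

lemma preserves_binary_tuples_iff:
  "preserves (n, f) 2 (binary_tuples \<rho>) \<longleftrightarrow>
     (\<forall>us vs. length us = n \<longrightarrow> list_all2 (\<lambda>x y. (x, y) \<in> \<rho>) us vs \<longrightarrow> (f us, f vs) \<in> \<rho>)"
proof -
  have two: "[0..<2] = [0, 1::nat]"
    by (simp add: upt_conv_Cons numeral_2_eq_2)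
  show ?thesis
  proof (intro iffI allI impI)
    fix us vs :: "'a list"
    assume pres: "preserves (n, f) 2 (binary_tuples \<rho>)"
      and len: "length us = n" and rel: "list_all2 (\<lambda>x y. (x, y) \<in> \<rho>) us vs"
    define rs where "rs = map2 (\<lambda>x y. [x, y]) us vs"
    have len_eq: "length us = length vs"
      using rel by (rule list_all2_lengthD)
    have rs: "length rs = n" "set rs \<subseteq> binary_tuples \<rho>"
      using rel len len_eq by (auto simp: rs_def binary_tuples_def list_all2_iff)
    have "map (\<lambda>r. r ! 0) rs = us" "map (\<lambda>r. r ! 1) rs = vs"
      using len_eq by (auto simp: rs_def intro: nth_equalityI)
    then have "[f us, f vs] \<in> binary_tuples \<rho>"
      using pres rs by (fastforce simp: two)
    then show "(f us, f vs) \<in> \<rho>"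
      by (auto simp: binary_tuples_def)
  next
    assume R: "\<forall>us vs. length us = n \<longrightarrow> list_all2 (\<lambda>x y. (x, y) \<in> \<rho>) us vs \<longrightarrow> (f us, f vs) \<in> \<rho>"
    have "(f (map (\<lambda>r. r ! 0) rs), f (map (\<lambda>r. r ! 1) rs)) \<in> \<rho>"
      if "length rs = n" "set rs \<subseteq> binary_tuples \<rho>" for rs
    proof -
      have "list_all2 (\<lambda>x y. (x, y) \<in> \<rho>) (map (\<lambda>r. r ! 0) rs) (map (\<lambda>r. r ! 1) rs)"
        using that(2) by (induction rs) (auto simp: binary_tuples_def)
      with R that(1) show ?thesis by simp
    qed
    then show "preserves (n, f) 2 (binary_tuples \<rho>)"
      by (auto simp: two binary_tuples_def)
  qed
qed

lemma Pol_preserves_rel: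
  assumes "(n, f) \<in> Pol A \<rho>" "length us = n" "list_all2 (\<lambda>x y. (x, y) \<in> \<rho>) us vs"
  shows "(f us, f vs) \<in> \<rho>"
  using assms by (simp add: Pol_def preserves_binary_tuples_iff del: preserves.simps)

lemma Pol_closed:
  assumes "(n, f) \<in> Pol A \<rho>" "us \<in> tuples A n"
  shows "f us \<in> A"
  using assms by (auto simp: Pol_def operations_def)

section \<open>Tuples, atoms and their behaviour under polymorphisms\<close>

lemma nth_tuples: "xs \<in> tuples A m \<Longrightarrow> i < m \<Longrightarrow> xs ! i \<in> A"
  by (auto simp: tuples_def)

lemma replicate_tuples: "a \<in> A \<Longrightarrow> replicate m a \<in> tuples A m"
  by (auto simp: tuples_def)

lemma finite_tuples: "finite A \<Longrightarrow> finite (tuples A m)"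
  using finite_lists_length_eq[of A m] by (simp add: tuples_def conj_commute)

text \<open>Formulas are lists of atoms, so the conjunction of all atoms valid on a relation is a
  formula only because of this finiteness.\<close>

lemma finite_atoms: "finite {\<alpha>. vars \<alpha> \<subseteq> {..<m}}"
proof (rule finite_subset)
  show "{\<alpha>. vars \<alpha> \<subseteq> {..<m}} \<subseteq>
      case_prod Rel_Atom ` ({..<m} \<times> {..<m}) \<union> case_prod Eq_Atom ` ({..<m} \<times> {..<m})"
  proof
    fix \<alpha> assume "\<alpha> \<in> {\<alpha>. vars \<alpha> \<subseteq> {..<m}}"
    then show "\<alpha> \<in> case_prod Rel_Atom ` ({..<m} \<times> {..<m}) \<union> case_prod Eq_Atom ` ({..<m} \<times> {..<m})"
      by (cases \<alpha>) auto
  qed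
qed simp

text \<open>Constant tuples make definable relations nonempty and, without quantifiers,
  reflexive.\<close>

lemma satisfies_replicate:
  assumes "refl_on A \<rho>" "a \<in> A" "vars \<alpha> \<subseteq> {..<m}"
  shows "satisfies \<rho> (replicate m a) \<alpha>"
  using assms by (cases \<alpha>) (auto dest: refl_onD)

text \<open>An atom compares just two columns of the matrix with rows \<open>ts\<close>. Columns
  related entrywise have related values under \<open>f\<close>, and equal columns have equal
  values.\<close>

lemma satisfies_Pol_image:
  assumes f: "(length ts, f) \<in> Pol A \<rho>"
    and sat: "\<forall>t\<in>set ts. satisfies \<rho> t \<alpha>" and vars: "vars \<alpha> \<subseteq> {..<m}"
  shows "satisfies \<rho> (map (\<lambda>i. f (map (\<lambda>t. t ! i) ts)) [0..<m]) \<alpha>"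
proof (cases \<alpha>)
  case (Rel_Atom i j)
  have "list_all2 (\<lambda>x y. (x, y) \<in> \<rho>) (map (\<lambda>t. t ! i) ts) (map (\<lambda>t. t ! j) ts)"
    using sat by (simp add: Rel_Atom list_all2_map1 list_all2_map2 list_all2_same)
  with f have "(f (map (\<lambda>t. t ! i) ts), f (map (\<lambda>t. t ! j) ts)) \<in> \<rho>"
    by (intro Pol_preserves_rel) simp_all
  then show ?thesis using vars by (simp add: Rel_Atom)
next
  case (Eq_Atom i j)
  have "map (\<lambda>t. t ! i) ts = map (\<lambda>t. t ! j) ts"
    using sat by (simp add: Eq_Atom)
  then have "f (map (\<lambda>t. t ! i) ts) = f (map (\<lambda>t. t ! j) ts)" by (rule arg_cong)
  then show ?thesis using vars by (simp add: Eq_Atom)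
qed

lemma Pol_image_tuples:
  assumes f: "(length ts, f) \<in> Pol A \<rho>" and ts: "set ts \<subseteq> tuples A m"
  shows "map (\<lambda>i. f (map (\<lambda>t. t ! i) ts)) [0..<m] \<in> tuples A m"
proof -
  have "f (map (\<lambda>t. t ! i) ts) \<in> A" if "i < m" for i
    using f by (rule Pol_closed) (use ts that in \<open>auto simp: tuples_def subset_iff\<close>)
  then show ?thesis by (auto simp: tuples_def)
qed

section \<open>Definable relations are invariant\<close>

lemma pp_definable_subset_Inv:
  assumes ne: "A \<noteq> {}" and refl: "refl_on A \<rho>"
  shows "pp_definable A \<rho> \<subseteq> Inv A (Pol A \<rho>)"
proof
  fix \<sigma> assume "\<sigma> \<in> pp_definable A \<rho>"
  then obtain m k \<phi> where m: "1 \<le> m" and vars: "\<forall>\<alpha>\<in>set \<phi>. vars \<alpha> \<subseteq> {..<m + k}"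
    and \<sigma>: "\<sigma> = {xs \<in> tuples A m. \<exists>ys\<in>tuples A k. \<forall>\<alpha>\<in>set \<phi>. satisfies \<rho> (xs @ ys) \<alpha>}"
    unfolding pp_definable_def by blast
  obtain a where a: "a \<in> A" using ne by blast
  \<comment> \<open>The same constant serves as a value for the quantified variables; this gives the
    nonemptiness demanded by \<open>relations\<close>.\<close>
  have "replicate m a \<in> \<sigma>"
    using a vars satisfies_replicate[OF refl a, of _ "m + k"]
    unfolding \<sigma> by (auto simp: replicate_add intro!: bexI[of _ "replicate k a"] replicate_tuples)
  then have "\<sigma> \<in> relations A m"
    by (auto simp: relations_def \<sigma>)
  moreover have "preserves (n, f) m \<sigma>" if f: "(n, f) \<in> Pol A \<rho>" for n f
    unfolding preserves.simps
  proof (intro allI impI)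
    fix rs assume len: "length rs = n" and rs: "set rs \<subseteq> \<sigma>"
    have "\<forall>r\<in>set rs. \<exists>ys. ys \<in> tuples A k \<and> (\<forall>\<alpha>\<in>set \<phi>. satisfies \<rho> (r @ ys) \<alpha>)"
      using rs unfolding \<sigma> by blast
    then obtain w where w: "\<And>r. r \<in> set rs \<Longrightarrow> w r \<in> tuples A k"
      "\<And>r \<alpha>. r \<in> set rs \<Longrightarrow> \<alpha> \<in> set \<phi> \<Longrightarrow> satisfies \<rho> (r @ w r) \<alpha>"
      by metis
    \<comment> \<open>Each row is extended by chosen witnesses. Applying \<open>f\<close> to the
      extended rows yields the image tuple \<open>?xs\<close> followed by \<open>?ys\<close>, so
      \<open>?ys\<close> witnesses the quantifiers for \<open>?xs\<close>.\<close>
    define ts where "ts = map (\<lambda>r. r @ w r) rs"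
    let ?xs = "map (\<lambda>i. f (map (\<lambda>r. r ! i) rs)) [0..<m]"
    let ?ys = "map (\<lambda>i. f (map (\<lambda>y. y ! i) (map w rs))) [0..<k]"
    have rs_len: "length r = m" if "r \<in> set rs" for r
      using that rs by (auto simp: \<sigma> tuples_def)
    have map_m: "map (\<lambda>r. r ! i) rs = map (\<lambda>t. t ! i) ts" if "i < m" for i
      using that rs_len by (simp add: ts_def nth_append)
    have map_k: "map (\<lambda>y. y ! i) (map w rs) = map (\<lambda>t. t ! (m + i)) ts" for i
      using rs_len by (simp add: ts_def nth_append)
    have "?xs @ ?ys = map (\<lambda>i. f (map (\<lambda>t. t ! i) ts)) [0..<m + k]"
      by (rule nth_equalityI) (auto simp: nth_append map_m map_k simp del: map_map)
    moreover have "\<forall>\<alpha>\<in>set \<phi>. satisfies \<rho> (map (\<lambda>i. f (map (\<lambda>t. t ! i) ts)) [0..<m + k]) \<alpha>"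
      using f vars w(2) len by (intro ballI satisfies_Pol_image) (auto simp: ts_def)
    moreover have "?xs \<in> tuples A m"
      using f rs len by (intro Pol_image_tuples) (auto simp: \<sigma>)
    moreover have "?ys \<in> tuples A k"
      using f w(1) len by (intro Pol_image_tuples) auto
    ultimately show "?xs \<in> \<sigma>" unfolding \<sigma> by (simp del: map_map) metis
  qed
  ultimately show "\<sigma> \<in> Inv A (Pol A \<rho>)"
    using m by (auto simp: Inv_def)
qed

section \<open>Invariant relations are definable without quantifiers\<close>

lemma mem_Inv_Pol_if_satisfies_atoms:
  assumes fin: "finite A" and eqv: "equiv A \<rho>"
    and \<sigma>: "\<sigma> \<in> relations A m" and inv: "\<And>g. g \<in> Pol A \<rho> \<Longrightarrow> preserves g m \<sigma>"
    and xs: "xs \<in> tuples A m"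
    and atoms: "\<And>\<alpha>. vars \<alpha> \<subseteq> {..<m} \<Longrightarrow> \<forall>r\<in>\<sigma>. satisfies \<rho> r \<alpha> \<Longrightarrow> satisfies \<rho> xs \<alpha>"
  shows "xs \<in> \<sigma>"
proof (cases "A = {}")
  case True
  \<comment> \<open>Since \<sigma> is nonempty, \<open>m = 0\<close>, and the empty tuple is the
    only candidate for \<open>xs\<close>.\<close>
  with \<sigma> xs show ?thesis by (auto simp: relations_def tuples_def)
next
  case False
  then obtain a where a: "a \<in> A" by blast
  have "finite \<sigma>" "\<sigma> \<noteq> {}" "\<sigma> \<subseteq> tuples A m"
    using \<sigma> finite_subset[OF _ finite_tuples[OF fin]] by (auto simp: relations_def)
  then obtain rs where rs: "set rs = \<sigma>" using finite_list by blast
  define n where "n = length rs"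
  define R where "R = list_all2 (\<lambda>x y. (x, y) \<in> \<rho>)"
  define col where "col i = map (\<lambda>r. r ! i) rs" for i
  \<comment> \<open>The rows of \<sigma> are the arguments of the operation to be built, whose arity
    must be positive.\<close>
  have n: "1 \<le> n" using rs \<open>\<sigma> \<noteq> {}\<close> by (cases rs) (auto simp: n_def)
  have R_sym: "R vs us" if "R us vs" for us vs
    using that eqv unfolding R_def list_all2_conv_all_nth by (auto elim!: equivE dest: symD)
  have R_trans: "R us ws" if "R us vs" "R vs ws" for us vs ws
    using that eqv unfolding R_def list_all2_conv_all_nth by (metis equivE transD)
  have col_tuples: "col i \<in> tuples A n" if "i < m" for i
    using nth_tuples[OF subsetD[OF \<open>\<sigma> \<subseteq> tuples A m\<close>] that]
    by (auto simp: col_def n_def rs tuples_def[of A "length rs"])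
  have R_refl: "R us us" if "us \<in> tuples A n" for us
    using that eqv unfolding R_def list_all2_same tuples_def by (auto elim!: equivE dest: refl_onD)
  \<comment> \<open>Columns \<open>i\<close> and \<open>j\<close> are related entrywise exactly when
    the relational atom on \<open>i\<close> and \<open>j\<close> holds throughout \<sigma>;
    \<open>xs_eq\<close> is the analogue for equality.\<close>
  have xs_rel: "(xs ! i, xs ! j) \<in> \<rho>" if "i < m" "j < m" "R (col i) (col j)" for i j
    using atoms[of "Rel_Atom i j"] that rs
    by (simp add: R_def col_def list_all2_map1 list_all2_map2 list_all2_same)
  have xs_eq: "xs ! i = xs ! j" if "i < m" "j < m" "col i = col j" for i j
    using atoms[of "Eq_Atom i j"] that rs by (simp add: col_def)
  \<comment> \<open>The indices \<open>i\<close> at which the value of \<open>u\<close> may be read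
    off from \<open>xs\<close>. The last conjunct forces a vector that is itself a column to be
    represented by an equal column, not merely by an equivalent one.\<close>
  define near where "near u i \<longleftrightarrow> i < m \<and> R u (col i) \<and> ((\<exists>j<m. u = col j) \<longrightarrow> u = col i)" for u i
  \<comment> \<open>Vectors without a representing column go to the fixed element \<open>a\<close>;
    \<open>restrict\<close> gives the extensionality required by \<open>operations\<close>.\<close>
  define f where "f = restrict (\<lambda>u. if \<exists>i. near u i then xs ! (SOME i. near u i) else a) (tuples A n)"
  have nearD: "i < m" "R u (col i)" if "near u i" for u i
    using that by (simp_all add: near_def)
  \<comment> \<open>If \<open>u\<close> is itself a column, its own index works, by reflexivity;
    otherwise \<open>i\<close> does.\<close>
  have near_ex: "\<exists>i. near u i" if "i < m" "R u (col i)" "u \<in> tuples A n" for u i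
    using that R_refl unfolding near_def by metis
  have f_near: "\<exists>i. near u i \<and> f u = xs ! i" if "u \<in> tuples A n" "near u i" for u i
    using that someI[of "near u" i] by (auto simp: f_def)
  have f_else: "f u = a" if "u \<in> tuples A n" "\<nexists>i. near u i" for u
    using that by (auto simp: f_def)
  have f_col: "f (col i) = xs ! i" if i: "i < m" for i
  proof -
    \<comment> \<open>The chosen index \<open>j\<close> may differ from \<open>i\<close>, but the
      two columns coincide, and then so do the entries of \<open>xs\<close>.\<close>
    obtain j where "near (col i) j" "f (col i) = xs ! j"
      using near_ex f_near i col_tuples R_refl by metis
    then show ?thesis using xs_eq i unfolding near_def by metis
  qed
  have "f \<in> tuples A n \<rightarrow>\<^sub>E A"
  proof
    fix u assume u: "u \<in> tuples A n"
    show "f u \<in> A"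
    proof (cases "\<exists>i. near u i")
      case True
      then obtain i where "near u i" "f u = xs ! i" using f_near u by blast
      then show ?thesis using nth_tuples[OF xs] by (simp add: near_def)
    next
      case False
      then show ?thesis using f_else u a by simp
    qed
  qed (simp add: f_def)
  moreover have "(f us, f vs) \<in> \<rho>" if len: "length us = n" and "R us vs" for us vs
  proof -
    \<comment> \<open>Being related entrywise places both argument lists over \<open>A\<close>, so
      \<open>f\<close> takes its defined values on them.\<close>
    have "\<rho> \<subseteq> A \<times> A" using eqv by (auto elim: equivE)
    then have t: "us \<in> tuples A n" "vs \<in> tuples A n"
      using len \<open>R us vs\<close> unfolding R_def tuples_def list_all2_conv_all_nth
      by (fastforce simp: in_set_conv_nth)+
    show ?thesis
    proof (cases "\<exists>i. near us i")
      case True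
      then obtain i where i: "near us i" "f us = xs ! i" using f_near t by blast
      then have vs_i: "R vs (col i)" using R_sym R_trans \<open>R us vs\<close> nearD(2) by blast
      then have "\<exists>j. near vs j" using near_ex nearD(1) i(1) t(2) by blast
      then obtain j where j: "near vs j" "f vs = xs ! j" using f_near t(2) by blast
      \<comment> \<open>The representatives of \<open>us\<close> and \<open>vs\<close> are chosen
        independently, but their columns are linked through \<open>vs\<close>; the \<rho>-atoms then
        relate the two values.\<close>
      have "R (col i) (col j)"
        by (rule R_trans[OF R_sym[OF vs_i] nearD(2)[OF j(1)]])
      then show ?thesis using xs_rel nearD(1) i j by simp
    next
      case False
      \<comment> \<open>Having a representative depends only on the class under \<open>R\<close>:
        one for \<open>vs\<close> would be equivalent to \<open>us\<close> as well. So both vectors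
        go to \<open>a\<close>, and reflexivity finishes.\<close>
      then have "\<nexists>i. near vs i"
        using near_ex[OF _ R_trans[OF \<open>R us vs\<close>] t(1)] nearD by blast
      with False show ?thesis using f_else t a eqv by (auto elim!: equivE dest: refl_onD)
    qed
  qed
  ultimately have "(n, f) \<in> Pol A \<rho>"
    using n unfolding Pol_def operations_def R_def
    by (simp only: mem_Collect_eq preserves_binary_tuples_iff) blast
  then have "map (\<lambda>i. f (col i)) [0..<m] \<in> \<sigma>"
    using inv[of "(n, f)"] rs by (simp add: n_def col_def)
  moreover have "map (\<lambda>i. f (col i)) [0..<m] = xs"
    using xs f_col by (intro nth_equalityI) (auto simp: tuples_def)
  ultimately show ?thesis by simp
qed

lemma Inv_Pol_subset_qf_pp_definable:
  assumes "finite A" "equiv A \<rho>"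
  shows "Inv A (Pol A \<rho>) \<subseteq> qf_pp_definable A \<rho>"
proof
  fix \<sigma> assume "\<sigma> \<in> Inv A (Pol A \<rho>)"
  then obtain m where m: "1 \<le> m" and \<sigma>: "\<sigma> \<in> relations A m"
    and inv: "\<And>g. g \<in> Pol A \<rho> \<Longrightarrow> preserves g m \<sigma>"
    unfolding Inv_def by blast
  have "finite {\<alpha>. vars \<alpha> \<subseteq> {..<m} \<and> (\<forall>r\<in>\<sigma>. satisfies \<rho> r \<alpha>)}"
    by (rule finite_subset[OF _ finite_atoms[of m]]) blast
  then obtain \<phi> where \<phi>: "set \<phi> = {\<alpha>. vars \<alpha> \<subseteq> {..<m} \<and> (\<forall>r\<in>\<sigma>. satisfies \<rho> r \<alpha>)}"
    by (auto dest: finite_list)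
  have "\<sigma> = {xs \<in> tuples A m. \<forall>\<alpha>\<in>set \<phi>. satisfies \<rho> xs \<alpha>}"
  proof (intro equalityI subsetI)
    fix xs assume "xs \<in> \<sigma>"
    then show "xs \<in> {xs \<in> tuples A m. \<forall>\<alpha>\<in>set \<phi>. satisfies \<rho> xs \<alpha>}"
      using \<sigma> by (auto simp: \<phi> relations_def)
  next
    fix xs assume "xs \<in> {xs \<in> tuples A m. \<forall>\<alpha>\<in>set \<phi>. satisfies \<rho> xs \<alpha>}"
    then show "xs \<in> \<sigma>"
      by (intro mem_Inv_Pol_if_satisfies_atoms[OF assms \<sigma> inv]) (simp_all add: \<phi>)
  qed
  then show "\<sigma> \<in> qf_pp_definable A \<rho>"
    using m unfolding qf_pp_definable_def by (fastforce simp: \<phi>)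
qed

section \<open>Comparison of the definable classes, and generalized quasiorders\<close>

lemma qf_pp_definable_subset_pp_definable: "qf_pp_definable A \<rho> \<subseteq> pp_definable A \<rho>"
proof
  fix \<sigma> assume "\<sigma> \<in> qf_pp_definable A \<rho>"
  then obtain m \<phi> where m: "1 \<le> m" and vars: "\<forall>\<alpha>\<in>set \<phi>. vars \<alpha> \<subseteq> {..<m}"
    and \<sigma>: "\<sigma> = {xs \<in> tuples A m. \<forall>\<alpha>\<in>set \<phi>. satisfies \<rho> xs \<alpha>}"
    unfolding qf_pp_definable_def by blast
  have "tuples A 0 = {[]}" by (auto simp: tuples_def)
  then have "\<sigma> = {xs \<in> tuples A m. \<exists>ys\<in>tuples A 0. \<forall>\<alpha>\<in>set \<phi>. satisfies \<rho> (xs @ ys) \<alpha>}"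
    by (simp add: \<sigma>)
  moreover have "\<forall>\<alpha>\<in>set \<phi>. vars \<alpha> \<subseteq> {..<m + 0}" using vars by simp
  ultimately show "\<sigma> \<in> pp_definable A \<rho>"
    using m unfolding pp_definable_def by blast
qed

text \<open>Each atom constrains only two coordinates, so ordinary reflexivity and transitivity of
  \<rho>, and of equality, lift to the generalized properties of a conjunction of atoms.\<close>

lemma gen_quasiorder_if_qf_pp_definable:
  assumes refl: "refl_on A \<rho>" and trans: "trans \<rho>" and "\<sigma> \<in> qf_pp_definable A \<rho>"
  shows "gen_quasiorder A \<sigma>"
proof -
  obtain m \<phi> where m: "1 \<le> m" and vars: "\<forall>\<alpha>\<in>set \<phi>. vars \<alpha> \<subseteq> {..<m}"
    and \<sigma>: "\<sigma> = {xs \<in> tuples A m. \<forall>\<alpha>\<in>set \<phi>. satisfies \<rho> xs \<alpha>}"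
    using assms(3) unfolding qf_pp_definable_def by blast
  have "gen_reflexive A m \<sigma>"
    using vars by (simp add: gen_reflexive_def \<sigma> satisfies_replicate[OF refl] replicate_tuples)
  moreover have "gen_transitive A m \<sigma>"
    unfolding gen_transitive_def
  proof (intro allI impI)
    fix M :: "nat \<Rightarrow> nat \<Rightarrow> 'a"
    assume M: "\<forall>i<m. \<forall>j<m. M i j \<in> A"
      and rows: "\<forall>i<m. map (\<lambda>j. M i j) [0..<m] \<in> \<sigma>"
      and cols: "\<forall>j<m. map (\<lambda>i. M i j) [0..<m] \<in> \<sigma>"
    have "satisfies \<rho> (map (\<lambda>i. M i i) [0..<m]) \<alpha>" if \<alpha>: "\<alpha> \<in> set \<phi>" for \<alpha>
    \<comment> \<open>The diagonal entries \<open>M i i\<close> and \<open>M j j\<close> are related through \<open>M i j\<close>, by row \<open>i\<close> and column \<open>j\<close>.\<close>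
    proof (cases \<alpha>)
      case (Rel_Atom i j)
      then have ij: "i < m" "j < m" using vars \<alpha> by auto
      have "(M i i, M i j) \<in> \<rho>" using rows \<alpha> ij unfolding \<sigma> Rel_Atom by fastforce
      moreover have "(M i j, M j j) \<in> \<rho>" using cols \<alpha> ij unfolding \<sigma> Rel_Atom by fastforce
      ultimately show ?thesis using trans ij by (auto simp: Rel_Atom dest: transD)
    next
      case (Eq_Atom i j)
      then have ij: "i < m" "j < m" using vars \<alpha> by auto
      have "M i i = M i j" using rows \<alpha> ij unfolding \<sigma> Eq_Atom by fastforce
      moreover have "M i j = M j j" using cols \<alpha> ij unfolding \<sigma> Eq_Atom by fastforce
      ultimately show ?thesis using ij by (simp add: Eq_Atom)
    qed
    moreover have "map (\<lambda>i. M i i) [0..<m] \<in> tuples A m"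
      using M by (auto simp: tuples_def)
    ultimately show "map (\<lambda>i. M i i) [0..<m] \<in> \<sigma>" unfolding \<sigma> by blast
  qed
  ultimately show ?thesis using m unfolding gen_quasiorder_def \<sigma> by blast
qed

theorem theorem5p2:
  fixes A :: "'a set" and \<rho> :: "('a \<times> 'a) set" and F :: "'a operation set"
  assumes "finite A" and "A \<noteq> {}"
    and "equiv A \<rho>"
    and "F = Pol A \<rho>"
  shows "gQuord A F = Inv A F \<and> Inv A F = pp_definable A \<rho> \<and> pp_definable A \<rho> = qf_pp_definable A \<rho>"
proof -
  have refl: "refl_on A \<rho>" and trans: "trans \<rho>"
    using assms(3) by (auto elim: equivE)
  \<comment> \<open>The equalities come from a cycle of inclusions: invariant relations are
    quantifier-free definable, these are definable, and definable ones are invariant. The first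
    inclusion also shows that every invariant relation is a generalized quasiorder.\<close>
  have Inv_qf: "Inv A F \<subseteq> qf_pp_definable A \<rho>"
    using Inv_Pol_subset_qf_pp_definable[OF assms(1,3)] by (simp add: assms(4))
  moreover have "pp_definable A \<rho> \<subseteq> Inv A F"
    using pp_definable_subset_Inv[OF assms(2) refl] by (simp add: assms(4))
  moreover have "gQuord A F = Inv A F"
    using Inv_qf gen_quasiorder_if_qf_pp_definable[OF refl trans]
    by (auto simp: gQuord_def)
  ultimately show ?thesis
    using qf_pp_definable_subset_pp_definable[of A \<rho>] by blast
qed

end
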